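(* Let $P$ be a PO system and $\{X_p\mid p\in P\}$ a trim $P$-partition of the primitive $\omega$-Stone space $W$, with $X_P=\bigcup_{p\in P}X_p$ and $\mathscr{X}_{\lim}=W-X_P$. Then: (1) for each ordinal $\xi$, $W^{[\xi]}=X_{P^{[\xi]}}$, $W^{(\xi)}=X_{P^{(\xi)}}\cup\mathscr{X}_{\lim}$, and $\{X_p\mid p\in P^{(\xi)}\}$ is a trim $P^{(\xi)}$-partition of the $\omega$-Stone space $W^{(\xi)}$; (2) $\nu(W)=\nu(P)$, $\lambda(W)=\lambda(P)$, $K(W)=X_{K(P)}\cup\mathscr{X}_{\lim}=\overline{X_{K(P)}}$, $K_\xi(W)=\overline{X_{K_\xi(P)}}$ for each $\xi$, $r_W(x)=r_P(p)$ for $p\in K(P)$ and $x\in X_p$, and $r_W(x)=\min\{r_P(p)\mid p\in I_x\}$ for $x\in\mathscr{X}_{\lim}$.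
   Context: An $\omega$-Stone space is a locally compact metrisable totally disconnected Hausdorff space. Space invariants: $S'$ the derived set; $W^{(0)}=W$, $W^{(\xi+1)}=(W^{(\xi)})'$, intersections at limits; $W^{[\xi]}=W^{(\xi)}-W^{(\xi+1)}$; $\nu(W)=\min\{\xi\mid W^{(\xi)}=W^{(\xi+1)}\}$; $K(W)=W^{(\nu(W))}$; $\lambda(W)=\min\{\xi\mid W^{(\xi)}-K(W)\text{ closed}\}$; $r_W(x)=\min\{\xi\mid x\notin\overline{W^{(\xi)}-K(W)}\}$ for $x\in K(W)$; $K_\xi(W)=\{w\in K(W)\mid r_W(w)>\xi\}$. Primitive: with $R$ the ring of compact open subsets of $W$ and $(A)=\{C\in R\mid C\subseteq A\}$, $A$ is PI if for all $B\subseteq A$ in $R$, $(B)\cong(A)$ or $(A-B)\cong(A)$; $W$ is primitive if every element of $R$ is a finite disjoint union of PI elements. PO systems: a set $P$ with antisymmetric transitive $<$; $p\leqslant q$ iff $p<q$ or $p=q$; $P^d=\{p\mid p\not<p\}$; $P_{\max}$ the $\leqslant$-maximal elements; $Q_\downarrow=\{p\mid p\leqslant q\text{ for some }q\in Q\}$. Cantor–Bendixson for $P$: $P'=P-(P_{\max}\cap P^d)$, $P^{(0)}=P$, $P^{(\xi+1)}=(P^{(\xi)})'$, $P^{(\eta)}=\bigcap_{\xi<\eta}P^{(\xi)}$ for limit $\eta$ (each $P^{(\xi)}$ with the induced relation); $P^{[\xi]}=P^{(\xi)}-P^{(\xi+1)}$; $\nu(P)=\min\{\xi\mid P^{(\xi)}=P^{(\xi+1)}\}$;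 $K(P)=P^{(\nu(P))}$; $\lambda(P)=\min\{\xi\mid P^{(\xi)}-K(P)\text{ is a lower subset of }P\}$; $r_P(p)=\min\{\xi\mid p\notin(P^{(\xi)}-K(P))_\downarrow\}$ for $p\in K(P)$; $K_\xi(P)=\{p\in K(P)\mid r_P(p)>\xi\}$. Partitions: for nonempty pairwise disjoint $X_p\subseteq W$, $X_Q=\bigcup_{p\in Q}X_p$. It is a $P$-partition if $X_p'\cap X_P=\bigcup_{q<p}X_q$ for all $p$. $T(Y)=\{p\mid Y\cap X_p\neq\emptyset\}$. A compact open $A$ is $p$-trim (and $t(A)=p$) if $T(A)=\{q\mid q\geqslant p\}$ and, when $p\in P^d$, $|A\cap X_p|=1$. Trim $P$-partition: (T1) each point has a neighbourhood base of trim sets; (T2) every point with a neighbourhood base of $p$-trim sets lies in $X_p$; (T3) each point of $X_p$ has a $p$-trim neighbourhood. For $x\in W$, $I_x=\{t(A)\mid A\text{ trim},\ x\in A\}$. *)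

theory Defs
  imports "HOL-Analysis.Analysis" "HOL-Algebra.QuotRing"
begin

text \<open>
  Ordinals are represented by the elements of an arbitrary well-ordered type without a greatest
  element: an element stands for the order type of the set of its predecessors. Every ordinal
  occurs in such a type. Minima over ordinals are written with \<open>LEAST\<close>; the type has to be long
  enough for them to be attained. For the derivatives of a space or of a PO system it suffices that
  the type has more elements than the underlying set, because each derivative that has not yet
  stabilised loses an element in the next step.
\<close>

definition osucc :: "'o::{wellorder,no_top} \<Rightarrow> 'o" where
  "osucc \<xi> = (LEAST \<eta>. \<xi> < \<eta>)"

lemma less_osucc: "\<xi> < osucc \<xi>"
  unfolding osucc_def by (rule LeastI_ex) (rule gt_ex)

lemma osucc_inject: "osucc \<xi> = osucc \<eta> \<longleftrightarrow> \<xi> = \<eta>"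
proof -
  have "osucc a \<noteq> osucc b" if "a < b" for a b :: 'a
    using that less_osucc[of b] Least_le[of "\<lambda>c. a < c" b] unfolding osucc_def by fastforce
  then show ?thesis by (metis neqE)
qed

function iterate_deriv ::
    "('a set \<Rightarrow> 'a set) \<Rightarrow> 'a set \<Rightarrow> 'o::{wellorder,no_top} \<Rightarrow> 'a set" where
  "iterate_deriv D A \<xi> =
     (if \<forall>\<eta>. \<xi> \<le> \<eta> then A
      else if \<exists>\<eta>. \<xi> = osucc \<eta> then D (iterate_deriv D A (THE \<eta>. \<xi> = osucc \<eta>))
      else (\<Inter>\<eta>\<in>{..<\<xi>}. iterate_deriv D A \<eta>))"
  by auto
termination
  by (relation "inv_image {(x, y). x < y} (\<lambda>(D, A, \<xi>). \<xi>)")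
     (auto simp: wf osucc_inject less_osucc)

declare iterate_deriv.simps [simp del]

lemma iterate_deriv_zero: "(\<And>\<eta>. \<xi> \<le> \<eta>) \<Longrightarrow> iterate_deriv D A \<xi> = A"
  by (simp add: iterate_deriv.simps)

lemma iterate_deriv_osucc: "iterate_deriv D A (osucc \<xi>) = D (iterate_deriv D A \<xi>)"
  using less_osucc[of \<xi>] by (subst iterate_deriv.simps) (auto simp: osucc_inject not_le[symmetric])

lemma iterate_deriv_limit:
  "\<zeta> < \<xi> \<Longrightarrow> (\<And>\<eta>. \<xi> \<noteq> osucc \<eta>) \<Longrightarrow>
    iterate_deriv D A \<xi> = (\<Inter>\<eta>\<in>{..<\<xi>}. iterate_deriv D A \<eta>)"
  by (subst iterate_deriv.simps) (auto simp: not_le[symmetric])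

text \<open>Separability is not required: every compact open subset is second countable, \<open>W\<close> need not be.\<close>

definition omega_Stone_space :: "'w topology \<Rightarrow> bool" where
  "omega_Stone_space W \<longleftrightarrow>
     locally_compact_space W \<and> metrizable_space W \<and> Hausdorff_space W \<and>
     (\<forall>x\<in>topspace W. connected_component_of_set W x = {x})"

text \<open>
  The derivatives are closed, so limit points taken in \<open>W\<close> agree with limit points taken in the
  derivative as a subspace.
\<close>

definition sp_deriv :: "'w topology \<Rightarrow> 'o::{wellorder,no_top} \<Rightarrow> 'w set" where
  "sp_deriv W = iterate_deriv (\<lambda>S. W derived_set_of S) (topspace W)"

definition sp_layer :: "'w topology \<Rightarrow> 'o::{wellorder,no_top} \<Rightarrow> 'w set" where
  "sp_layer W \<xi> = sp_deriv W \<xi> - sp_deriv W (osucc \<xi>)"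

definition sp_nu :: "'w topology \<Rightarrow> 'o::{wellorder,no_top}" where
  "sp_nu W = (LEAST \<xi>. sp_deriv W \<xi> = sp_deriv W (osucc \<xi>))"

text \<open>
  The kernel does not mention ordinals in its type; the \<open>itself\<close> argument names the type of
  ordinals in which the derivatives are taken.
\<close>

definition sp_K :: "'o::{wellorder,no_top} itself \<Rightarrow> 'w topology \<Rightarrow> 'w set" where
  "sp_K _ W = sp_deriv W (sp_nu W :: 'o)"

definition sp_lambda :: "'w topology \<Rightarrow> 'o::{wellorder,no_top}" where
  "sp_lambda W = (LEAST \<xi>::'o. closedin W (sp_deriv W \<xi> - sp_K TYPE('o) W))"

definition sp_r :: "'w topology \<Rightarrow> 'w \<Rightarrow> 'o::{wellorder,no_top}" where
  "sp_r W x = (LEAST \<xi>::'o. x \<notin> W closure_of (sp_deriv W \<xi> - sp_K TYPE('o) W))"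

definition sp_K_level :: "'w topology \<Rightarrow> 'o::{wellorder,no_top} \<Rightarrow> 'w set" where
  "sp_K_level W \<xi> = {w \<in> sp_K TYPE('o) W. sp_r W w > \<xi>}"

definition compact_open :: "'w topology \<Rightarrow> 'w set \<Rightarrow> bool" where
  "compact_open W A \<longleftrightarrow> compactin W A \<and> openin W A"

text \<open>
  The Boolean ring of compact open subsets of \<open>A\<close>. Its unit is \<open>A\<close>, and a bijection preserving
  sums and products preserves the unit, so isomorphisms may be taken to be unital.
\<close>

definition ring_below :: "'w topology \<Rightarrow> 'w set \<Rightarrow> 'w set ring" where
  "ring_below W A =
     \<lparr>carrier = {C. compact_open W C \<and> C \<subseteq> A},
      monoid.mult = (\<inter>), one = A, zero = {}, add = sym_diff\<rparr>"

definition PI :: "'w topology \<Rightarrow> 'w set \<Rightarrow> bool" where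
  "PI W A \<longleftrightarrow> compact_open W A \<and>
     (\<forall>B. compact_open W B \<and> B \<subseteq> A \<longrightarrow>
        is_ring_iso (ring_below W B) (ring_below W A) \<or>
        is_ring_iso (ring_below W (A - B)) (ring_below W A))"

definition primitive_space :: "'w topology \<Rightarrow> bool" where
  "primitive_space W \<longleftrightarrow>
     (\<forall>A. compact_open W A \<longrightarrow>
        (\<exists>\<F>. finite \<F> \<and> disjoint \<F> \<and> (\<forall>B\<in>\<F>. PI W B) \<and> \<Union>\<F> = A))"

text \<open>
  A PO system is a carrier set with a relation, which need not be reflexive or irreflexive
  (\<open>lt p p\<close> may hold for some \<open>p\<close> and fail for others). An induced PO system keeps the relation and shrinks the carrier.
\<close>

definition PO_system :: "'p set \<Rightarrow> ('p \<Rightarrow> 'p \<Rightarrow> bool) \<Rightarrow> bool" where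
  "PO_system P lt \<longleftrightarrow> antisymp_on P lt \<and> transp_on P lt"

definition po_le :: "('p \<Rightarrow> 'p \<Rightarrow> bool) \<Rightarrow> 'p \<Rightarrow> 'p \<Rightarrow> bool" where
  "po_le lt p q \<longleftrightarrow> lt p q \<or> p = q"

definition po_d :: "('p \<Rightarrow> 'p \<Rightarrow> bool) \<Rightarrow> 'p set \<Rightarrow> 'p set" where
  "po_d lt P = {p \<in> P. \<not> lt p p}"

definition po_max :: "('p \<Rightarrow> 'p \<Rightarrow> bool) \<Rightarrow> 'p set \<Rightarrow> 'p set" where
  "po_max lt P = {p \<in> P. \<forall>q\<in>P. po_le lt p q \<longrightarrow> q = p}"

definition po_down :: "'p set \<Rightarrow> ('p \<Rightarrow> 'p \<Rightarrow> bool) \<Rightarrow> 'p set \<Rightarrow> 'p set" where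
  "po_down P lt Q = {p \<in> P. \<exists>q\<in>Q. po_le lt p q}"

definition po_lower_subset :: "'p set \<Rightarrow> ('p \<Rightarrow> 'p \<Rightarrow> bool) \<Rightarrow> 'p set \<Rightarrow> bool" where
  "po_lower_subset P lt Q \<longleftrightarrow> Q \<subseteq> P \<and> (\<forall>q\<in>Q. \<forall>p\<in>P. po_le lt p q \<longrightarrow> p \<in> Q)"

definition po_deriv ::
    "'p set \<Rightarrow> ('p \<Rightarrow> 'p \<Rightarrow> bool) \<Rightarrow> 'o::{wellorder,no_top} \<Rightarrow> 'p set" where
  "po_deriv P lt = iterate_deriv (\<lambda>Q. Q - (po_max lt Q \<inter> po_d lt Q)) P"

definition po_layer ::
    "'p set \<Rightarrow> ('p \<Rightarrow> 'p \<Rightarrow> bool) \<Rightarrow> 'o::{wellorder,no_top} \<Rightarrow> 'p set" where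
  "po_layer P lt \<xi> = po_deriv P lt \<xi> - po_deriv P lt (osucc \<xi>)"

definition po_nu :: "'p set \<Rightarrow> ('p \<Rightarrow> 'p \<Rightarrow> bool) \<Rightarrow> 'o::{wellorder,no_top}" where
  "po_nu P lt = (LEAST \<xi>. po_deriv P lt \<xi> = po_deriv P lt (osucc \<xi>))"

definition po_K ::
    "'o::{wellorder,no_top} itself \<Rightarrow> 'p set \<Rightarrow> ('p \<Rightarrow> 'p \<Rightarrow> bool) \<Rightarrow> 'p set" where
  "po_K _ P lt = po_deriv P lt (po_nu P lt :: 'o)"

definition po_lambda :: "'p set \<Rightarrow> ('p \<Rightarrow> 'p \<Rightarrow> bool) \<Rightarrow> 'o::{wellorder,no_top}" where
  "po_lambda P lt =
     (LEAST \<xi>::'o. po_lower_subset P lt (po_deriv P lt \<xi> - po_K TYPE('o) P lt))"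

definition po_r :: "'p set \<Rightarrow> ('p \<Rightarrow> 'p \<Rightarrow> bool) \<Rightarrow> 'p \<Rightarrow> 'o::{wellorder,no_top}" where
  "po_r P lt p =
     (LEAST \<xi>::'o. p \<notin> po_down P lt (po_deriv P lt \<xi> - po_K TYPE('o) P lt))"

definition po_K_level ::
    "'p set \<Rightarrow> ('p \<Rightarrow> 'p \<Rightarrow> bool) \<Rightarrow> 'o::{wellorder,no_top} \<Rightarrow> 'p set" where
  "po_K_level P lt \<xi> = {p \<in> po_K TYPE('o) P lt. po_r P lt p > \<xi>}"

definition part_union :: "('p \<Rightarrow> 'w set) \<Rightarrow> 'p set \<Rightarrow> 'w set" where
  "part_union X Q = (\<Union>p\<in>Q. X p)"

definition P_partition ::
    "'w topology \<Rightarrow> 'p set \<Rightarrow> ('p \<Rightarrow> 'p \<Rightarrow> bool) \<Rightarrow> ('p \<Rightarrow> 'w set) \<Rightarrow> bool" where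
  "P_partition W P lt X \<longleftrightarrow>
     (\<forall>p\<in>P. X p \<noteq> {} \<and> X p \<subseteq> topspace W) \<and> disjoint_family_on X P \<and>
     (\<forall>p\<in>P. W derived_set_of (X p) \<inter> part_union X P = part_union X {q \<in> P. lt q p})"

definition part_type :: "'p set \<Rightarrow> ('p \<Rightarrow> 'w set) \<Rightarrow> 'w set \<Rightarrow> 'p set" where
  "part_type P X Y = {p \<in> P. Y \<inter> X p \<noteq> {}}"

definition p_trim ::
    "'w topology \<Rightarrow> 'p set \<Rightarrow> ('p \<Rightarrow> 'p \<Rightarrow> bool) \<Rightarrow> ('p \<Rightarrow> 'w set) \<Rightarrow> 'p \<Rightarrow> 'w set \<Rightarrow> bool" where
  "p_trim W P lt X p A \<longleftrightarrow> p \<in> P \<and> compact_open W A \<and>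
     part_type P X A = {q \<in> P. po_le lt p q} \<and>
     (p \<in> po_d lt P \<longrightarrow> card (A \<inter> X p) = 1)"

definition trim ::
    "'w topology \<Rightarrow> 'p set \<Rightarrow> ('p \<Rightarrow> 'p \<Rightarrow> bool) \<Rightarrow> ('p \<Rightarrow> 'w set) \<Rightarrow> 'w set \<Rightarrow> bool" where
  "trim W P lt X A \<longleftrightarrow> (\<exists>p\<in>P. p_trim W P lt X p A)"

definition trim_type ::
    "'w topology \<Rightarrow> 'p set \<Rightarrow> ('p \<Rightarrow> 'p \<Rightarrow> bool) \<Rightarrow> ('p \<Rightarrow> 'w set) \<Rightarrow> 'w set \<Rightarrow> 'p" where
  "trim_type W P lt X A = (THE p. p_trim W P lt X p A)"

lemma trim_type_eq:
  assumes "PO_system P lt" "p_trim W P lt X p A"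
  shows "trim_type W P lt X A = p"
  unfolding trim_type_def
proof (rule the_equality)
  fix q assume "p_trim W P lt X q A"
  with assms(2) have *: "p \<in> P" "q \<in> P" "{r \<in> P. po_le lt p r} = {r \<in> P. po_le lt q r}"
    by (auto simp: p_trim_def)
  then have "po_le lt p q" "po_le lt q p"
    by (auto simp: po_le_def)
  with * assms(1) show "q = p"
    by (auto simp: PO_system_def po_le_def dest: antisymp_onD)
qed (fact assms(2))

definition trim_partition ::
    "'w topology \<Rightarrow> 'p set \<Rightarrow> ('p \<Rightarrow> 'p \<Rightarrow> bool) \<Rightarrow> ('p \<Rightarrow> 'w set) \<Rightarrow> bool" where
  "trim_partition W P lt X \<longleftrightarrow> P_partition W P lt X \<and>
     neighbourhood_base_of (trim W P lt X) W \<and>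
     (\<forall>p\<in>P. \<forall>x\<in>topspace W. neighbourhood_base_at x (p_trim W P lt X p) W \<longrightarrow> x \<in> X p) \<and>
     (\<forall>p\<in>P. \<forall>x\<in>X p. \<exists>A. p_trim W P lt X p A \<and> x \<in> A)"

definition trim_types_at ::
    "'w topology \<Rightarrow> 'p set \<Rightarrow> ('p \<Rightarrow> 'p \<Rightarrow> bool) \<Rightarrow> ('p \<Rightarrow> 'w set) \<Rightarrow> 'w \<Rightarrow> 'p set" where
  "trim_types_at W P lt X x = {trim_type W P lt X A |A. trim W P lt X A \<and> x \<in> A}"

definition limit_part :: "'w topology \<Rightarrow> 'p set \<Rightarrow> ('p \<Rightarrow> 'w set) \<Rightarrow> 'w set" where
  "limit_part W P X = topspace W - part_union X P"

end

(* The type of a trim set A is the least element of T(A), and the types of the trim neighbourhoods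
   of x decide whether x lies in the closure of X_Q: it does iff each of them lies below some
   element of Q. The Cantor-Bendixson induction preserves two properties of Q = P^(xi): Q is a lower
   set, and every trim set that meets the limit part has its type in Q. They make X_Q together with
   the limit part closed and trim-partitioned by Q, and its isolated points are the X_p with p maximal
   in Q and not p < p. The statements on nu, lambda, K and r follow from the closure criterion. *)
theory Submission
  imports Defs
begin

section \<open>Ordinal induction, iterated derivatives and minima\<close>

lemma le_of_less_osucc:
  fixes \<xi> \<eta> :: "'o::{wellorder,no_top}"
  assumes "\<xi> < osucc \<eta>"
  shows "\<xi> \<le> \<eta>"
  using assms not_less_Least[of \<xi> "\<lambda>\<zeta>. \<eta> < \<zeta>"] unfolding osucc_def by auto

text \<open>An element that is neither least nor a successor has something below it, so the three
  cases match the defining clauses of \<open>iterate_deriv\<close>.\<close>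

lemma osucc_limit_induct [case_names zero osucc limit]:
  fixes \<xi> :: "'o::{wellorder,no_top}"
  assumes "\<And>\<xi>. (\<And>\<eta>. \<xi> \<le> \<eta>) \<Longrightarrow> R \<xi>"
    and "\<And>\<xi>. R \<xi> \<Longrightarrow> R (osucc \<xi>)"
    and "\<And>\<xi> \<zeta>. \<zeta> < \<xi> \<Longrightarrow> (\<And>\<eta>. \<xi> \<noteq> osucc \<eta>) \<Longrightarrow> (\<And>\<eta>. \<eta> < \<xi> \<Longrightarrow> R \<eta>) \<Longrightarrow> R \<xi>"
  shows "R \<xi>"
proof (induction \<xi> rule: less_induct)
  case (less \<xi>)
  show ?case
  proof (cases "\<exists>\<eta>. \<xi> = osucc \<eta>")
    case True
    then show ?thesis using assms(2) less less_osucc by blast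
  next
    case False
    then show ?thesis using assms(1,3) less by (metis not_le)
  qed
qed

text \<open>Successors apply the shrinking \<open>D\<close> once more and limits intersect all
  earlier stages. This later turns the minimum defining \<open>po_r\<close> into a
  threshold.\<close>

lemma iterate_deriv_antimono:
  fixes \<xi> \<eta> :: "'o::{wellorder,no_top}"
  assumes D: "\<And>S. D S \<subseteq> S" and "\<xi> \<le> \<eta>"
  shows "iterate_deriv D A \<eta> \<subseteq> iterate_deriv D A \<xi>"
  using \<open>\<xi> \<le> \<eta>\<close>
proof (induction \<eta> rule: osucc_limit_induct)
  case (zero \<eta>)
  then show ?case by (metis antisym order_refl)
next
  case (osucc \<eta>)
  then show ?case
    using D[of "iterate_deriv D A \<eta>"] le_of_less_osucc[of \<xi> \<eta>]
    by (cases "\<xi> = osucc \<eta>") (auto simp: iterate_deriv_osucc)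
next
  case (limit \<eta> \<zeta>)
  then show ?case
    by (cases "\<xi> = \<eta>") (auto simp: iterate_deriv_limit[of \<zeta> \<eta>])
qed

text \<open>The least individual minimum is a value at which some \<open>S p\<close> holds;
  conversely, the \<open>p\<close> that witnesses the left minimum has its own minimum no larger.
  The second assumption makes every individual \<open>LEAST\<close> a genuine minimum. With
  \<open>S p\<close> saying that \<open>p\<close> has left a lower set indexed by \<xi>, this gives
  the formula for r at limit points.\<close>

lemma Least_Bex_eq_Least_image:
  fixes S :: "'a \<Rightarrow> 'o::wellorder \<Rightarrow> bool"
  assumes "I \<noteq> {}" and "\<And>p. p \<in> I \<Longrightarrow> \<exists>\<xi>. S p \<xi>"
  shows "(LEAST \<xi>. \<exists>p\<in>I. S p \<xi>) = (LEAST \<alpha>. \<alpha> \<in> (\<lambda>p. LEAST \<xi>. S p \<xi>) ` I)"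
proof (rule antisym)
  have "(LEAST \<alpha>. \<alpha> \<in> (\<lambda>p. LEAST \<xi>. S p \<xi>) ` I) \<in> (\<lambda>p. LEAST \<xi>. S p \<xi>) ` I"
    by (rule LeastI_ex) (use assms(1) in blast)
  then obtain p where p: "p \<in> I" "(LEAST \<alpha>. \<alpha> \<in> (\<lambda>p. LEAST \<xi>. S p \<xi>) ` I) = (LEAST \<xi>. S p \<xi>)"
    by blast
  then have "S p (LEAST \<xi>. S p \<xi>)" using assms(2) LeastI_ex[of "S p"] by blast
  with p show "(LEAST \<xi>. \<exists>p\<in>I. S p \<xi>) \<le> (LEAST \<alpha>. \<alpha> \<in> (\<lambda>p. LEAST \<xi>. S p \<xi>) ` I)"
    by (auto intro: Least_le)
next
  have "\<exists>p\<in>I. S p (LEAST \<xi>. \<exists>p\<in>I. S p \<xi>)"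
    by (rule LeastI_ex) (use assms in blast)
  then obtain p where "p \<in> I" "S p (LEAST \<xi>. \<exists>p\<in>I. S p \<xi>)" by blast
  then show "(LEAST \<alpha>. \<alpha> \<in> (\<lambda>p. LEAST \<xi>. S p \<xi>) ` I) \<le> (LEAST \<xi>. \<exists>p\<in>I. S p \<xi>)"
    by (meson Least_le imageI order_trans)
qed

text \<open>A connected subset of the subspace is connected in \<open>W\<close>, so components can
  only shrink; closedness preserves local compactness.\<close>

lemma omega_Stone_space_closed_subspace:
  assumes "omega_Stone_space W" and "closedin W S"
  shows "omega_Stone_space (subtopology W S)"
proof -
  have "connected_component_of_set (subtopology W S) x = {x}"
    if "x \<in> topspace (subtopology W S)" for x
  proof
    have "x \<in> topspace W" using that by simp
    moreover have "connected_component_of_set (subtopology W S) x \<subseteq> connected_component_of_set W x"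
      by (auto simp: connected_component_of_def connectedin_subtopology)
    ultimately show "connected_component_of_set (subtopology W S) x \<subseteq> {x}"
      using assms(1) unfolding omega_Stone_space_def by blast
    show "{x} \<subseteq> connected_component_of_set (subtopology W S) x"
      using that by (simp add: connected_component_of_refl)
  qed
  then show ?thesis
    using assms unfolding omega_Stone_space_def
    by (meson Hausdorff_space_subtopology locally_compact_space_closed_subset
        metrizable_space_subtopology)
qed

section \<open>Blocks of a trim partition and the types of trim sets\<close>

locale trim_partitioned_space =
  fixes W :: "'w topology" and P :: "'p set" and lt :: "'p \<Rightarrow> 'p \<Rightarrow> bool" and X :: "'p \<Rightarrow> 'w set"
  assumes Hausdorff: "Hausdorff_space W"
    and PO: "PO_system P lt"
    and trim_partition: "trim_partition W P lt X"
begin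

abbreviation le where "le \<equiv> po_le lt"
abbreviation limpts where "limpts \<equiv> limit_part W P X"

lemma le_antisym: "le p q \<Longrightarrow> le q p \<Longrightarrow> p \<in> P \<Longrightarrow> q \<in> P \<Longrightarrow> p = q"
  using PO by (auto simp: PO_system_def po_le_def dest: antisymp_onD)

lemma le_trans: "le p q \<Longrightarrow> le q r \<Longrightarrow> p \<in> P \<Longrightarrow> q \<in> P \<Longrightarrow> r \<in> P \<Longrightarrow> le p r"
  using PO unfolding PO_system_def po_le_def by (metis transp_onD)

lemma X_subset: "p \<in> P \<Longrightarrow> X p \<subseteq> topspace W"
  and X_nonempty: "p \<in> P \<Longrightarrow> X p \<noteq> {}"
  using trim_partition by (auto simp: trim_partition_def P_partition_def)

lemma X_disjoint:
  assumes "x \<in> X p" "x \<in> X q" "p \<in> P" "q \<in> P"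
  shows "p = q"
proof -
  have "disjoint_family_on X P"
    using trim_partition by (simp add: trim_partition_def P_partition_def)
  then show ?thesis using assms unfolding disjoint_family_on_def by blast
qed

lemma derived_X:
  "p \<in> P \<Longrightarrow> W derived_set_of (X p) \<inter> part_union X P = part_union X {q \<in> P. lt q p}"
  using trim_partition by (auto simp: trim_partition_def P_partition_def)

lemma X_subset_derived: "p \<in> P \<Longrightarrow> q \<in> P \<Longrightarrow> lt p q \<Longrightarrow> X p \<subseteq> W derived_set_of X q"
  using derived_X[of q] by (fastforce simp: part_union_def)

text \<open>Blocks are nonempty and pairwise disjoint, so a point of a block reveals its index.
  Through this the derivatives of \<open>W\<close> and of \<open>P\<close> stabilise
  together.\<close>

lemma part_union_inj:
  assumes "Q \<subseteq> P" "R \<subseteq> P" "part_union X Q = part_union X R"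
  shows "Q = R"
proof -
  have "p \<in> R'" if "p \<in> Q'" "Q' \<subseteq> P" "R' \<subseteq> P" "part_union X Q' = part_union X R'" for p Q' R'
  proof -
    from that have "X p \<noteq> {}" "X p \<subseteq> part_union X R'"
      using X_nonempty unfolding part_union_def by blast+
    then obtain x q where "x \<in> X p" "q \<in> R'" "x \<in> X q" unfolding part_union_def by blast
    then show ?thesis using that X_disjoint[of x p q] by blast
  qed
  with assms show ?thesis by (metis subsetI subset_antisym)
qed

lemma part_union_Diff:
  assumes "Q \<subseteq> P" "R \<subseteq> P"
  shows "part_union X (Q - R) = part_union X Q - part_union X R"
  using assms X_disjoint by (fastforce simp: part_union_def)

lemma mem_part_union_iff:
  assumes "Q \<subseteq> P" "p \<in> P" "x \<in> X p"
  shows "x \<in> part_union X Q \<longleftrightarrow> p \<in> Q"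
  using assms X_disjoint by (auto simp: part_union_def)

lemma limit_part_disjoint: "Q \<subseteq> P \<Longrightarrow> part_union X Q \<inter> limpts = {}"
  by (auto simp: limit_part_def part_union_def)

lemma part_union_subset: "Q \<subseteq> P \<Longrightarrow> part_union X Q \<subseteq> topspace W"
  using X_subset by (fastforce simp: part_union_def)

lemma trim_le: "p_trim W P lt X p A \<Longrightarrow> x \<in> A \<Longrightarrow> x \<in> X q \<Longrightarrow> q \<in> P \<Longrightarrow> le p q"
  by (auto simp: p_trim_def part_type_def)

lemma trim_meets: "p_trim W P lt X p A \<Longrightarrow> le p q \<Longrightarrow> q \<in> P \<Longrightarrow> A \<inter> X q \<noteq> {}"
  by (auto simp: p_trim_def part_type_def)

lemma trim_type_mem: "p_trim W P lt X p A \<Longrightarrow> p \<in> P"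
  by (simp add: p_trim_def)

lemma trim_openin: "p_trim W P lt X p A \<Longrightarrow> openin W A"
  by (simp add: p_trim_def compact_open_def)

lemma trim_meets_self: "p_trim W P lt X p A \<Longrightarrow> A \<inter> X p \<noteq> {}"
  using trim_meets[of p A p] trim_type_mem by (auto simp: po_le_def)

lemma obtain_trim:
  assumes "openin W U" "x \<in> U"
  obtains p A where "p_trim W P lt X p A" "x \<in> A" "A \<subseteq> U"
  using assms trim_partition
  unfolding trim_partition_def neighbourhood_base_of trim_def by (meson subsetD)

lemma obtain_X_trim:
  assumes "p \<in> P" "x \<in> X p"
  obtains A where "p_trim W P lt X p A" "x \<in> A"
  using assms trim_partition unfolding trim_partition_def by blast

lemma mem_X_if_neighbourhood_base:
  "p \<in> P \<Longrightarrow> x \<in> topspace W \<Longrightarrow> neighbourhood_base_at x (p_trim W P lt X p) W \<Longrightarrow> x \<in> X p"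
  using trim_partition unfolding trim_partition_def by blast

text \<open>By antisymmetry a trim set has only one type (\<open>trim_type_eq\<close>), so the
  definite description can be traded for an existential.\<close>

lemma trim_types_at_eq: "trim_types_at W P lt X x = {p. \<exists>A. p_trim W P lt X p A \<and> x \<in> A}"
  unfolding trim_types_at_def trim_def
  using trim_type_eq[OF PO] by (fastforce simp: trim_type_mem)

lemma trim_types_at_subset: "trim_types_at W P lt X x \<subseteq> P"
  by (auto simp: trim_types_at_eq trim_type_mem)

lemma trim_types_at_nonempty: "x \<in> topspace W \<Longrightarrow> trim_types_at W P lt X x \<noteq> {}"
  using obtain_trim[OF openin_topspace] by (metis (mono_tags) emptyE mem_Collect_eq trim_types_at_eq)

section \<open>Closures of unions of blocks\<close>

text \<open>A \<open>p\<close>-trim set meets \<open>X q\<close> exactly when \<open>le p q\<close>,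
  and trim sets form a neighbourhood base, so looking for points of the union near \<open>x\<close>
  amounts to comparing types.\<close>

lemma mem_closure_iff:
  assumes "x \<in> topspace W" "Q \<subseteq> P"
  shows "x \<in> W closure_of part_union X Q \<longleftrightarrow> trim_types_at W P lt X x \<subseteq> po_down P lt Q"
proof
  assume x: "x \<in> W closure_of part_union X Q"
  show "trim_types_at W P lt X x \<subseteq> po_down P lt Q"
  proof
    fix p assume "p \<in> trim_types_at W P lt X x"
    then obtain A where A: "p_trim W P lt X p A" "x \<in> A" by (auto simp: trim_types_at_eq)
    then obtain y where "y \<in> A" "y \<in> part_union X Q"
      using x trim_openin[OF A(1)] unfolding in_closure_of by blast
    then obtain q where "q \<in> Q" "y \<in> X q" by (auto simp: part_union_def)
    then have "le p q" using trim_le[OF A(1) \<open>y \<in> A\<close>] assms(2) by blast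
    with \<open>q \<in> Q\<close> show "p \<in> po_down P lt Q"
      using trim_type_mem[OF A(1)] by (auto simp: po_down_def)
  qed
next
  assume *: "trim_types_at W P lt X x \<subseteq> po_down P lt Q"
  show "x \<in> W closure_of part_union X Q"
    unfolding in_closure_of
  proof (intro conjI allI impI)
    fix U assume "x \<in> U \<and> openin W U"
    then obtain p A where A: "p_trim W P lt X p A" "x \<in> A" "A \<subseteq> U" using obtain_trim by metis
    then obtain q where q: "q \<in> Q" "le p q" using * by (auto simp: trim_types_at_eq po_down_def)
    then obtain y where "y \<in> A" "y \<in> X q" using A(1) trim_meets assms(2) by blast
    with q A(3) show "\<exists>y. y \<in> part_union X Q \<and> y \<in> U" by (auto simp: part_union_def)
  qed (fact assms(1))
qed

text \<open>Every type at a point of \<open>X p\<close> lies below \<open>p\<close>, and (T3) makes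
  \<open>p\<close> itself one of these types. Since \<open>po_down P lt Q\<close> is a lower set,
  \<open>p\<close> decides for all of them.\<close>

lemma mem_closure_X_iff:
  assumes "x \<in> X p" "p \<in> P" "Q \<subseteq> P"
  shows "x \<in> W closure_of part_union X Q \<longleftrightarrow> p \<in> po_down P lt Q"
proof -
  have "p \<in> trim_types_at W P lt X x"
    using obtain_X_trim[OF assms(2,1)] by (auto simp: trim_types_at_eq)
  moreover have "q \<in> po_down P lt Q" if "q \<in> trim_types_at W P lt X x" "p \<in> po_down P lt Q" for q
  proof -
    have "le q p" using that(1) trim_le assms by (auto simp: trim_types_at_eq)
    then show ?thesis
      using that assms(2,3) trim_types_at_subset le_trans unfolding po_down_def
      by (smt (verit, ccfv_threshold) mem_Collect_eq subsetD)
  qed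
  ultimately show ?thesis
    using mem_closure_iff[of x Q] assms X_subset by blast
qed

section \<open>Saturated lower sets and the trim partitions they induce\<close>

text \<open>The second clause says that I_x is contained in \<open>Q\<close> for every limit point
  x. Both clauses survive intersections of nonempty families, as limit stages require.\<close>

definition limit_saturated :: "'p set \<Rightarrow> bool" where
  "limit_saturated Q \<longleftrightarrow> po_lower_subset P lt Q \<and>
     (\<forall>p A. p_trim W P lt X p A \<and> A \<inter> limpts \<noteq> {} \<longrightarrow> p \<in> Q)"

abbreviation part_space :: "'p set \<Rightarrow> 'w set" where
  "part_space Q \<equiv> part_union X Q \<union> limpts"

lemma limit_saturated_subset: "limit_saturated Q \<Longrightarrow> Q \<subseteq> P"
  by (auto simp: limit_saturated_def po_lower_subset_def)

text \<open>At a limit point the second clause of saturation applies; at a point of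
  \<open>X q\<close> with \<open>q\<close> in \<open>Q\<close> the type lies below \<open>q\<close>,
  and \<open>Q\<close> is a lower set.\<close>

lemma limit_saturated_trim:
  assumes "limit_saturated Q" "p_trim W P lt X p A" "x \<in> A" "x \<in> part_space Q"
  shows "p \<in> Q"
proof (cases "x \<in> limpts")
  case True
  then show ?thesis using assms unfolding limit_saturated_def by blast
next
  case False
  then obtain q where "q \<in> Q" "x \<in> X q" using assms(4) by (auto simp: part_union_def)
  then have "le p q" using trim_le assms limit_saturated_subset by blast
  with \<open>q \<in> Q\<close> show ?thesis
    using assms(1,2) trim_type_mem by (auto simp: limit_saturated_def po_lower_subset_def)
qed

lemma topspace_eq: "topspace W = part_space P"
  using part_union_subset[of P] by (auto simp: limit_part_def)

text \<open>A point outside lies in some \<open>X p\<close> with \<open>p\<close> not in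
  \<open>Q\<close>. Its \<open>p\<close>-trim neighbourhood misses \<open>part_space Q\<close>,
  since otherwise \<open>p\<close> would lie in \<open>Q\<close>.\<close>

lemma closedin_part_space:
  assumes "limit_saturated Q"
  shows "closedin W (part_space Q)"
proof -
  have "openin W (topspace W - part_space Q)"
  proof (subst openin_subopen, intro ballI)
    fix x assume x: "x \<in> topspace W - part_space Q"
    then obtain p where p: "p \<in> P" "x \<in> X p" by (auto simp: topspace_eq part_union_def)
    then have "p \<notin> Q" using x by (auto simp: part_union_def)
    obtain A where A: "p_trim W P lt X p A" "x \<in> A" using obtain_X_trim p by blast
    then have "A \<inter> part_space Q = {}" using limit_saturated_trim assms \<open>p \<notin> Q\<close> by blast
    moreover have "openin W A" using A(1) by (rule trim_openin)
    ultimately show "\<exists>U. openin W U \<and> x \<in> U \<and> U \<subseteq> topspace W - part_space Q"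
      using A(2) openin_subset by (intro exI[of _ A]) blast
  qed
  then show ?thesis
    using part_union_subset limit_saturated_subset assms
    by (auto simp: closedin_def limit_part_def)
qed

lemma part_type_Int_part_space:
  "Q \<subseteq> P \<Longrightarrow> part_type Q X (A \<inter> part_space Q) = part_type P X A \<inter> Q"
  by (auto simp: part_type_def part_union_def)

text \<open>Closedness keeps the trace compact, and \<open>X p\<close> lies inside
  \<open>part_space Q\<close>, so the one-point condition for irreflexive \<open>p\<close> is
  inherited.\<close>

lemma p_trim_subtopology:
  assumes Q: "limit_saturated Q" and A: "p_trim W P lt X p A" and "p \<in> Q"
  shows "p_trim (subtopology W (part_space Q)) Q lt X p (A \<inter> part_space Q)"
proof -
  have "compactin W (A \<inter> part_space Q)"
    using closedin_part_space[OF Q] A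
    by (metis p_trim_def compact_open_def closed_Int_compactin inf_commute)
  then have "compact_open (subtopology W (part_space Q)) (A \<inter> part_space Q)"
    using A trim_openin
    by (auto simp: compact_open_def compactin_subtopology openin_subtopology)
  moreover have "A \<inter> part_space Q \<inter> X p = A \<inter> X p"
    using \<open>p \<in> Q\<close> by (auto simp: part_union_def)
  ultimately show ?thesis
    using A \<open>p \<in> Q\<close> part_type_Int_part_space[OF limit_saturated_subset[OF Q]]
      limit_saturated_subset[OF Q]
    by (auto simp: p_trim_def po_d_def)
qed

text \<open>Since \<open>X p\<close> lies in the subspace, its derived set there is the trace of the
  one in \<open>W\<close>, and the partition identity only has to be cut down to the blocks of
  \<open>Q\<close>.\<close>

lemma P_partition_subtopology:
  assumes "Q \<subseteq> P"
  shows "P_partition (subtopology W (part_space Q)) Q lt X"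
proof -
  let ?V = "subtopology W (part_space Q)"
  have "disjoint_family_on X Q"
    using trim_partition assms disjoint_family_on_mono
    unfolding trim_partition_def P_partition_def by blast
  moreover have "?V derived_set_of X p \<inter> part_union X Q = part_union X {q \<in> Q. lt q p}"
    if "p \<in> Q" for p
  proof -
    have "part_space Q \<inter> X p = X p" using that by (auto simp: part_union_def)
    then have "?V derived_set_of X p \<inter> part_union X Q
        = (W derived_set_of X p \<inter> part_union X P) \<inter> part_union X Q"
      using assms by (auto simp: derived_set_of_subtopology part_union_def)
    also have "\<dots> = part_union X {q \<in> P. lt q p} \<inter> part_union X Q"
      using derived_X that assms by (simp add: subset_iff)
    also have "\<dots> = part_union X {q \<in> Q. lt q p}"
      using assms X_disjoint by (fastforce simp: part_union_def)
    finally show ?thesis .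
  qed
  moreover have "X p \<noteq> {} \<and> X p \<subseteq> topspace ?V" if "p \<in> Q" for p
    using that assms X_nonempty[of p] X_subset[of p] by (auto simp: part_union_def)
  ultimately show ?thesis unfolding P_partition_def by blast
qed

text \<open>(T1) and (T3) follow by taking traces of trim sets of \<open>W\<close>. (T2) goes the
  other way: a base of \<open>p\<close>-trim sets in the subspace has to yield one in
  \<open>W\<close>, which comes from showing that all sufficiently small trim neighbourhoods of
  \<open>x\<close> in \<open>W\<close> have type \<open>p\<close>.\<close>

lemma trim_partition_subtopology:
  assumes Q: "limit_saturated Q"
  shows "trim_partition (subtopology W (part_space Q)) Q lt X"
proof -
  let ?V = "subtopology W (part_space Q)"
  have QP: "Q \<subseteq> P" using Q by (rule limit_saturated_subset)
  have T1: "neighbourhood_base_of (trim ?V Q lt X) ?V"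
    unfolding neighbourhood_base_of
  proof (intro allI impI)
    fix U x assume "openin ?V U \<and> x \<in> U"
    then obtain O' where O': "openin W O'" "U = O' \<inter> part_space Q" "x \<in> O'" "x \<in> part_space Q"
      by (auto simp: openin_subtopology)
    then obtain p A where A: "p_trim W P lt X p A" "x \<in> A" "A \<subseteq> O'" using obtain_trim by metis
    then have "p \<in> Q" using limit_saturated_trim[OF Q] O' by blast
    then have "p_trim ?V Q lt X p (A \<inter> part_space Q)" using p_trim_subtopology Q A by blast
    then have "openin ?V (A \<inter> part_space Q)" "trim ?V Q lt X (A \<inter> part_space Q)"
      using \<open>p \<in> Q\<close> by (auto simp: p_trim_def compact_open_def trim_def)
    with O' A show "\<exists>U' B. openin ?V U' \<and> trim ?V Q lt X B \<and> x \<in> U' \<and> U' \<subseteq> B \<and> B \<subseteq> U"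
      by (intro exI[of _ "A \<inter> part_space Q"]) auto
  qed
  have T2: "x \<in> X p"
    if "p \<in> Q" and xV: "x \<in> topspace ?V" and base: "neighbourhood_base_at x (p_trim ?V Q lt X p) ?V" for p x
  proof (rule mem_X_if_neighbourhood_base)
    show "p \<in> P" "x \<in> topspace W" using that QP by auto
    have obtain_V: "\<exists>B. p_trim ?V Q lt X p B \<and> x \<in> B \<and> B \<subseteq> U" if "openin ?V U" "x \<in> U" for U
      using base that unfolding neighbourhood_base_at_def by (meson subsetD)
    \<comment> \<open>\<open>B\<close> supplies an open \<open>O'\<close> of \<open>W\<close> for
      the first inequality: a trim set of type \<open>q\<close> in \<open>Q\<close> that fits inside
      \<open>O'\<close> meets \<open>X q\<close> within \<open>B\<close>, whence
      \<open>le p q\<close>.\<close>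
    obtain B where B: "p_trim ?V Q lt X p B" "x \<in> B"
      using obtain_V[OF openin_topspace xV] by blast
    then obtain O' where O': "openin W O'" "B = O' \<inter> part_space Q"
      by (auto simp: p_trim_def compact_open_def openin_subtopology)
    show "neighbourhood_base_at x (p_trim W P lt X p) W"
      unfolding neighbourhood_base_at_def
    proof (intro allI impI)
      fix U assume U: "openin W U \<and> x \<in> U"
      then have "openin W (U \<inter> O')" "x \<in> U \<inter> O'" using O' B by auto
      then obtain q A where A: "p_trim W P lt X q A" "x \<in> A" "A \<subseteq> U \<inter> O'"
        using obtain_trim by metis
      have "q \<in> Q" using limit_saturated_trim[OF Q A(1,2)] xV by simp
      then have "q \<in> part_type Q X B"
        using trim_meets_self[OF A(1)] A(3) O' by (auto simp: part_type_def part_union_def)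
      then have "le p q" using B(1) by (auto simp: p_trim_def)
      \<comment> \<open>For the reverse inequality, a \<open>p\<close>-trim set of the subspace fits
        inside the trace of \<open>A\<close>, so \<open>A\<close> meets \<open>X p\<close>.\<close>
      have "openin ?V (A \<inter> part_space Q)" "x \<in> A \<inter> part_space Q"
        using A trim_openin xV by (auto simp: openin_subtopology)
      then obtain C where C: "p_trim ?V Q lt X p C" "C \<subseteq> A" using obtain_V by blast
      then have "C \<inter> X p \<noteq> {}"
        using \<open>p \<in> Q\<close> by (auto simp: p_trim_def part_type_def po_le_def)
      then have "le q p" using trim_le[OF A(1)] C(2) \<open>p \<in> P\<close> by blast
      then have "q = p" using \<open>le p q\<close> le_antisym \<open>p \<in> P\<close> \<open>q \<in> Q\<close> QP by blast
      then show "\<exists>U' B. openin W U' \<and> p_trim W P lt X p B \<and> x \<in> U' \<and> U' \<subseteq> B \<and> B \<subseteq> U"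
        using A trim_openin by blast
    qed
  qed
  have T3: "\<exists>A. p_trim ?V Q lt X p A \<and> x \<in> A" if "p \<in> Q" "x \<in> X p" for p x
  proof -
    have "p \<in> P" using that QP by blast
    then obtain A where "p_trim W P lt X p A" "x \<in> A" using obtain_X_trim \<open>x \<in> X p\<close> by blast
    moreover have "x \<in> part_space Q" using that by (auto simp: part_union_def)
    ultimately show ?thesis using p_trim_subtopology[OF Q] that by blast
  qed
  show ?thesis
    unfolding trim_partition_def using P_partition_subtopology[OF QP] T1 T2 T3 by blast
qed

section \<open>Isolated points and the derivative\<close>

text \<open>Irreflexivity of \<open>p\<close> leaves \<open>x\<close> as the only point of
  \<open>X p\<close> in \<open>A\<close>. A second point of \<open>part_space Q\<close> in
  \<open>A\<close> would have a trim neighbourhood in \<open>A - {x}\<close> whose type is in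
  \<open>Q\<close> and above \<open>p\<close>, hence equal to \<open>p\<close> by maximality; it
  would then meet \<open>X p\<close> away from \<open>x\<close>.\<close>

lemma maximal_trim:
  assumes Q: "limit_saturated Q" and p: "p \<in> po_max lt Q \<inter> po_d lt Q"
    and A: "p_trim W P lt X p A" and x: "x \<in> A" "x \<in> X p"
  shows "A \<inter> part_space Q = {x}"
proof -
  have QP: "Q \<subseteq> P" using Q by (rule limit_saturated_subset)
  have "p \<in> P" "p \<in> Q" "p \<in> po_d lt P" using p QP by (auto simp: po_d_def)
  then have "card (A \<inter> X p) = 1" using A by (simp add: p_trim_def)
  then have single: "A \<inter> X p = {x}" using x by (metis IntI One_nat_def card_1_singletonE singletonD)
  have max: "q = p" if "q \<in> Q" "le p q" for q
    using p that by (auto simp: po_max_def)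
  have "y = x" if y: "y \<in> A" "y \<in> part_space Q" for y
  proof (rule ccontr)
    assume "y \<noteq> x"
    have "openin W A" using A by (rule trim_openin)
    moreover have "closedin W {x}"
      using Hausdorff X_subset \<open>p \<in> P\<close> x by (simp add: closedin_Hausdorff_singleton subset_iff)
    ultimately have "openin W (A - {x})" "y \<in> A - {x}" using y \<open>y \<noteq> x\<close> by auto
    then obtain r B where B: "p_trim W P lt X r B" "y \<in> B" "B \<subseteq> A - {x}"
      using obtain_trim by metis
    have "r \<in> Q" using limit_saturated_trim[OF Q B(1,2) y(2)] .
    moreover have "le p r"
      using trim_meets_self[OF B(1)] trim_le[OF A] B(3) trim_type_mem[OF B(1)] by blast
    ultimately have "B \<inter> X p \<noteq> {}" using max trim_meets_self[OF B(1)] by blast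
    then show False using single B(3) by blast
  qed
  moreover have "x \<in> part_space Q" using \<open>p \<in> Q\<close> x unfolding part_union_def by blast
  ultimately show ?thesis using x(1) by blast
qed

text \<open>A removed element below a remaining one would equal it by maximality, so a lower set
  remains. A trim set whose type is removed meets \<open>part_space Q\<close> in one point, which
  belongs to a block, so it contains no limit point.\<close>

lemma limit_saturated_deriv:
  assumes Q: "limit_saturated Q"
  shows "limit_saturated (Q - (po_max lt Q \<inter> po_d lt Q))"
  unfolding limit_saturated_def
proof (intro conjI allI impI)
  have "p \<in> po_max lt Q \<longrightarrow> p = q" if "p \<in> P" "q \<in> Q" "le p q" for p q
    using that by (auto simp: po_max_def)
  then show "po_lower_subset P lt (Q - (po_max lt Q \<inter> po_d lt Q))"
    using Q unfolding limit_saturated_def po_lower_subset_def by blast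
next
  fix p A assume A: "p_trim W P lt X p A \<and> A \<inter> limpts \<noteq> {}"
  then have "p \<in> Q" using Q by (auto simp: limit_saturated_def)
  moreover have False if p: "p \<in> po_max lt Q \<inter> po_d lt Q"
  proof -
    obtain x where "x \<in> A" "x \<in> X p" using A trim_meets_self by blast
    then have "A \<inter> part_space Q = {x}" using maximal_trim[OF Q p] A by blast
    moreover have "A \<inter> limpts \<subseteq> A \<inter> part_space Q" by blast
    ultimately have "x \<in> limpts" using A by (metis Int_iff subset_singletonD insertI1)
    with \<open>x \<in> X p\<close> show False
      using A trim_type_mem by (auto simp: limit_part_def part_union_def)
  qed
  ultimately show "p \<in> Q - (po_max lt Q \<inter> po_d lt Q)" by blast
qed

text \<open>Points with removed index are isolated by \<open>maximal_trim\<close>. Conversely, the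
  type of a trim set that isolates a point turns out to be maximal and irreflexive in
  \<open>Q\<close> and to be the index of that point.\<close>

lemma derived_part_space:
  assumes Q: "limit_saturated Q"
  shows "W derived_set_of part_space Q = part_space (Q - (po_max lt Q \<inter> po_d lt Q))"
    (is "?L = ?R")
proof
  have QP: "Q \<subseteq> P" using Q by (rule limit_saturated_subset)
  show "?L \<subseteq> ?R"
  proof
    fix x assume x: "x \<in> ?L"
    then have "x \<in> part_space Q"
      using closedin_part_space[OF Q] by (meson closedin_contains_derived_set subsetD)
    moreover have False if p: "p \<in> po_max lt Q \<inter> po_d lt Q" "x \<in> X p" for p
    proof -
      have "p \<in> P" using p QP by (auto simp: po_max_def)
      then obtain A where A: "p_trim W P lt X p A" "x \<in> A" using obtain_X_trim p by blast
      then have "A \<inter> part_space Q = {x}" using maximal_trim Q p by blast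
      with x A trim_openin show False by (fastforce simp: in_derived_set_of)
    qed
    ultimately show "x \<in> ?R" by (auto simp: part_union_def)
  qed
  show "?R \<subseteq> ?L"
  proof (rule ccontr)
    assume "\<not> ?thesis"
    then obtain x where x: "x \<in> ?R" "x \<notin> ?L" by blast
    have "x \<in> part_space Q" using x by (auto simp: part_union_def)
    then have "x \<in> topspace W" using closedin_part_space[OF Q] closedin_subset by blast
    then obtain U where U: "openin W U" "x \<in> U" "U \<inter> part_space Q \<subseteq> {x}"
      using x by (auto simp: in_derived_set_of)
    then obtain q A where A: "p_trim W P lt X q A" "x \<in> A" "A \<subseteq> U" using obtain_trim by metis
    have "q \<in> Q" using limit_saturated_trim[OF Q A(1,2)] \<open>x \<in> part_space Q\<close> by blast
    \<comment> \<open>\<open>A\<close> must meet every \<open>X r\<close> with \<open>r\<close> in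
      \<open>Q\<close> above \<open>q\<close>, yet \<open>x\<close> is its only point in
      \<open>part_space Q\<close>. Disjointness then leaves \<open>q\<close> as the sole such
      \<open>r\<close>.\<close>
    have up: "x \<in> X r" if "r \<in> Q" "le q r" for r
    proof -
      have "A \<inter> X r \<noteq> {}" using trim_meets[OF A(1)] that QP by blast
      moreover have "A \<inter> X r \<subseteq> {x}" using that A U by (auto simp: part_union_def)
      ultimately show ?thesis by blast
    qed
    then have xq: "x \<in> X q" using \<open>q \<in> Q\<close> by (auto simp: po_le_def)
    have "r = q" if "r \<in> Q" "le q r" for r
      using up[OF that] xq that(1) \<open>q \<in> Q\<close> QP by (intro X_disjoint) auto
    then have "q \<in> po_max lt Q"
      using \<open>q \<in> Q\<close> by (simp add: po_max_def)
    moreover have "\<not> lt q q"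
    proof
      assume "lt q q"
      then have "x \<in> W derived_set_of X q" using X_subset_derived \<open>q \<in> Q\<close> QP xq by blast
      moreover have "X q \<subseteq> part_space Q" using \<open>q \<in> Q\<close> by (auto simp: part_union_def)
      ultimately show False using x derived_set_of_mono by blast
    qed
    ultimately have "q \<in> po_max lt Q \<inter> po_d lt Q" using \<open>q \<in> Q\<close> by (simp add: po_d_def)
    \<comment> \<open>Lying in the block \<open>X q\<close>, the point is no limit point, so its
      place in \<open>?R\<close> would have to come from a remaining index, whereas its index
      \<open>q\<close> is removed.\<close>
    moreover have "x \<in> part_union X (Q - (po_max lt Q \<inter> po_d lt Q))"
      using x(1) xq \<open>q \<in> Q\<close> QP by (auto simp: limit_part_def part_union_def)
    ultimately show False
      using mem_part_union_iff[of "Q - (po_max lt Q \<inter> po_d lt Q)" q x] xq \<open>q \<in> Q\<close> QP by blast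
  qed
qed

section \<open>The Cantor-Bendixson induction\<close>

text \<open>Saturation is carried through the induction because \<open>derived_part_space\<close>
  assumes it at each successor step.\<close>

lemma sp_deriv_eq_part_space:
  fixes \<xi> :: "'o::{wellorder,no_top}"
  shows "limit_saturated (po_deriv P lt \<xi>) \<and> sp_deriv W \<xi> = part_space (po_deriv P lt \<xi>)"
proof (induction \<xi> rule: osucc_limit_induct)
  case (zero \<xi>)
  then have "po_deriv P lt \<xi> = P" "sp_deriv W \<xi> = topspace W"
    unfolding po_deriv_def sp_deriv_def by (rule iterate_deriv_zero)+
  moreover have "limit_saturated P"
    by (auto simp: limit_saturated_def po_lower_subset_def trim_type_mem)
  ultimately show ?case by (simp only: topspace_eq)
next
  case (osucc \<xi>)
  then show ?case
    using limit_saturated_deriv[of "po_deriv P lt \<xi>"] derived_part_space[of "po_deriv P lt \<xi>"]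
    unfolding sp_deriv_def po_deriv_def iterate_deriv_osucc by simp
next
  case (limit \<xi> \<zeta>)
  have po: "po_deriv P lt \<xi> = (\<Inter>\<eta>\<in>{..<\<xi>}. po_deriv P lt \<eta>)"
    and sp: "sp_deriv W \<xi> = (\<Inter>\<eta>\<in>{..<\<xi>}. sp_deriv W \<eta>)"
    unfolding sp_deriv_def po_deriv_def
    by (rule iterate_deriv_limit[OF limit.hyps])+
  have IH: "limit_saturated (po_deriv P lt \<eta>)" "sp_deriv W \<eta> = part_space (po_deriv P lt \<eta>)"
    if "\<eta> < \<xi>" for \<eta> using limit.IH that by auto
  \<comment> \<open>The element \<open>\<zeta>\<close> makes the intersection nonempty, which keeps
    it inside \<open>P\<close>.\<close>
  have "limit_saturated (po_deriv P lt \<xi>)"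
    using IH(1) \<open>\<zeta> < \<xi>\<close> unfolding po limit_saturated_def po_lower_subset_def by blast
  moreover have "sp_deriv W \<xi> = part_space (po_deriv P lt \<xi>)"
  proof
    show "sp_deriv W \<xi> \<subseteq> part_space (po_deriv P lt \<xi>)"
    proof
      fix x assume "x \<in> sp_deriv W \<xi>"
      then have x: "x \<in> part_space (po_deriv P lt \<eta>)" if "\<eta> < \<xi>" for \<eta>
        using IH(2) that sp by auto
      show "x \<in> part_space (po_deriv P lt \<xi>)"
      proof (cases "x \<in> limpts")
        case False
        \<comment> \<open>The index \<open>p\<close> is read off at the single stage
          \<open>\<zeta>\<close>; disjointness of the blocks forces the same index at every other
          stage.\<close>
        then obtain p where p: "p \<in> P" "x \<in> X p"
          using x[OF \<open>\<zeta> < \<xi>\<close>] limit_saturated_subset[OF IH(1)[OF \<open>\<zeta> < \<xi>\<close>]]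
          by (auto simp: part_union_def)
        then have "p \<in> po_deriv P lt \<eta>" if "\<eta> < \<xi>" for \<eta>
          using False x[OF that] limit_saturated_subset[OF IH(1)[OF that]] X_disjoint
          by (auto simp: part_union_def)
        with p show ?thesis by (auto simp: part_union_def po)
      qed simp
    qed
    show "part_space (po_deriv P lt \<xi>) \<subseteq> sp_deriv W \<xi>"
      unfolding sp po using IH(2) by (auto simp: part_union_def)
  qed
  ultimately show ?case by blast
qed

lemma saturated_po_deriv: "limit_saturated (po_deriv P lt \<xi>)"
  and sp_deriv_eq: "sp_deriv W \<xi> = part_space (po_deriv P lt \<xi>)"
  by (simp_all add: sp_deriv_eq_part_space)

lemma po_deriv_subset: "po_deriv P lt \<xi> \<subseteq> P"
  by (rule limit_saturated_subset[OF saturated_po_deriv])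

section \<open>Layers, stabilisation and kernels\<close>

lemma part_space_eq_iff:
  assumes "Q \<subseteq> P" "R \<subseteq> P"
  shows "part_space Q = part_space R \<longleftrightarrow> Q = R"
proof
  assume "part_space Q = part_space R"
  then have "part_union X Q = part_union X R"
    using limit_part_disjoint[OF assms(1)] limit_part_disjoint[OF assms(2)] by blast
  then show "Q = R" by (rule part_union_inj[OF assms])
qed simp

lemma part_space_Diff:
  assumes "Q \<subseteq> P" "R \<subseteq> P"
  shows "part_space Q - part_space R = part_union X (Q - R)"
  using limit_part_disjoint[OF assms(1)] unfolding part_union_Diff[OF assms] by blast

lemma sp_layer_eq: "sp_layer W \<xi> = part_union X (po_layer P lt \<xi>)"
  unfolding sp_layer_def po_layer_def sp_deriv_eq
  by (rule part_space_Diff[OF po_deriv_subset po_deriv_subset])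

lemma sp_nu_eq: "sp_nu W = po_nu P lt"
  unfolding sp_nu_def po_nu_def sp_deriv_eq
  by (simp add: part_space_eq_iff po_deriv_subset)

lemma saturated_po_K: "limit_saturated (po_K TYPE('o::{wellorder,no_top}) P lt)"
  unfolding po_K_def by (rule saturated_po_deriv)

lemma po_K_subset: "po_K TYPE('o::{wellorder,no_top}) P lt \<subseteq> P"
  by (rule limit_saturated_subset[OF saturated_po_K])

lemma sp_K_eq: "sp_K TYPE('o::{wellorder,no_top}) W = part_space (po_K TYPE('o) P lt)"
  unfolding sp_K_def po_K_def sp_nu_eq by (rule sp_deriv_eq)

text \<open>The limit part lies in every derivative and in the kernel, so it cancels. This reduces
  lambda and r to closures of unions of blocks.\<close>

lemma sp_deriv_minus_K:
  "sp_deriv W (\<xi>::'o::{wellorder,no_top}) - sp_K TYPE('o) W =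
     part_union X (po_deriv P lt \<xi> - po_K TYPE('o) P lt)"
  unfolding sp_deriv_eq sp_K_eq by (rule part_space_Diff[OF po_deriv_subset po_K_subset])

section \<open>Closed unions of blocks, lambda and r\<close>

lemma saturated_types_at_limit_part:
  "limit_saturated Q \<Longrightarrow> x \<in> limpts \<Longrightarrow> trim_types_at W P lt X x \<subseteq> Q"
  by (auto simp: limit_saturated_def trim_types_at_eq)

text \<open>Closedness of \<open>part_space Q\<close> bounds the closure from above; each limit
  point has all its types in \<open>Q\<close> and so passes the closure criterion.\<close>

lemma closure_part_union_saturated:
  assumes "limit_saturated Q"
  shows "W closure_of part_union X Q = part_space Q"
proof
  show "W closure_of part_union X Q \<subseteq> part_space Q"
    by (rule closure_of_minimal[OF Un_upper1 closedin_part_space[OF assms]])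
  have "Q \<subseteq> po_down P lt Q"
    using limit_saturated_subset[OF assms] by (auto simp: po_down_def po_le_def)
  then have "x \<in> W closure_of part_union X Q" if "x \<in> limpts" for x
    using mem_closure_iff[of x Q] saturated_types_at_limit_part[OF assms that]
      limit_saturated_subset[OF assms] that
    unfolding limit_part_def by blast
  moreover have "part_union X Q \<subseteq> W closure_of part_union X Q"
    by (rule closure_of_subset[OF part_union_subset[OF limit_saturated_subset[OF assms]]])
  ultimately show "part_space Q \<subseteq> W closure_of part_union X Q" by blast
qed

text \<open>If \<open>p\<close> lies below an element of \<open>Q\<close>, then \<open>X p\<close>
  lies in the closure. Conversely, for lower \<open>Q\<close> all types at a closure point are in
  \<open>Q\<close>. The set \<open>K\<close> excludes limit points: their types, of which there is
  at least one, would lie in \<open>K\<close> too. In the application \<open>K\<close> is the kernel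
  of \<open>P\<close>.\<close>

lemma closedin_part_union_iff:
  assumes "limit_saturated K" "Q \<subseteq> P" "Q \<inter> K = {}"
  shows "closedin W (part_union X Q) \<longleftrightarrow> po_lower_subset P lt Q"
proof
  assume closed: "closedin W (part_union X Q)"
  have "p \<in> Q" if "q \<in> Q" "p \<in> P" "le p q" for p q
  proof -
    obtain x where "x \<in> X p" using X_nonempty \<open>p \<in> P\<close> by blast
    have "p \<in> po_down P lt Q" using that by (auto simp: po_down_def)
    then have "x \<in> W closure_of part_union X Q"
      using mem_closure_X_iff[OF \<open>x \<in> X p\<close> \<open>p \<in> P\<close> assms(2)] by blast
    then have "x \<in> part_union X Q" using closed by (simp add: closure_of_closedin)
    then show ?thesis using mem_part_union_iff[OF assms(2) \<open>p \<in> P\<close> \<open>x \<in> X p\<close>] by blast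
  qed
  then show "po_lower_subset P lt Q" using assms(2) by (auto simp: po_lower_subset_def)
next
  assume lower: "po_lower_subset P lt Q"
  then have down: "po_down P lt Q \<subseteq> Q" by (auto simp: po_lower_subset_def po_down_def)
  have "x \<in> part_union X Q" if x: "x \<in> W closure_of part_union X Q" for x
  proof -
    have "x \<in> topspace W" using x by (simp add: in_closure_of)
    then have types: "trim_types_at W P lt X x \<subseteq> Q"
      using mem_closure_iff[OF _ assms(2)] x down by blast
    then have "x \<notin> limpts"
      using saturated_types_at_limit_part[OF assms(1)] assms(3)
        trim_types_at_nonempty[OF \<open>x \<in> topspace W\<close>] by blast
    then obtain p where "p \<in> P" "x \<in> X p"
      using \<open>x \<in> topspace W\<close> by (auto simp: limit_part_def part_union_def)
    then show ?thesis
      using mem_closure_X_iff[OF _ _ assms(2)] x down unfolding part_union_def by blast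
  qed
  then have "W closure_of part_union X Q \<subseteq> part_union X Q" by blast
  then show "closedin W (part_union X Q)"
    using part_union_subset[OF assms(2)] by (simp add: closure_of_subset_eq[symmetric])
qed

lemma sp_lambda_eq: "(sp_lambda W :: 'o::{wellorder,no_top}) = po_lambda P lt"
proof -
  have "closedin W (part_union X (po_deriv P lt \<xi> - po_K TYPE('o) P lt)) \<longleftrightarrow>
        po_lower_subset P lt (po_deriv P lt \<xi> - po_K TYPE('o) P lt)" for \<xi> :: 'o
    using po_deriv_subset by (intro closedin_part_union_iff[OF saturated_po_K]) blast+
  then show ?thesis unfolding sp_lambda_def po_lambda_def sp_deriv_minus_K by simp
qed

lemma sp_r_eq_po_r:
  assumes "p \<in> P" "x \<in> X p"
  shows "(sp_r W x :: 'o::{wellorder,no_top}) = po_r P lt p"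
proof -
  have "x \<in> W closure_of part_union X (po_deriv P lt \<xi> - po_K TYPE('o) P lt) \<longleftrightarrow>
        p \<in> po_down P lt (po_deriv P lt \<xi> - po_K TYPE('o) P lt)" for \<xi> :: 'o
    using po_deriv_subset by (intro mem_closure_X_iff[OF assms(2,1)]) blast
  then show ?thesis unfolding sp_r_def po_r_def sp_deriv_minus_K by simp
qed

text \<open>At the witness the derivative is the kernel by definition, so the difference is empty.
  Hence the minimum defining \<open>po_r\<close> is attained.\<close>

lemma ex_notin_po_down:
  "\<exists>\<xi>::'o::{wellorder,no_top}. p \<notin> po_down P lt (po_deriv P lt \<xi> - po_K TYPE('o) P lt)"
  by (rule exI[of _ "po_nu P lt"]) (simp add: po_K_def po_down_def)

text \<open>By the closure criterion \<open>x\<close> is outside the closure as soon as one of its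
  types is outside the down-set, so the minimum over \<xi> passes to the types.\<close>

lemma sp_r_eq_Least:
  assumes "x \<in> topspace W"
  shows "(sp_r W x :: 'o::{wellorder,no_top}) = (LEAST \<alpha>. \<alpha> \<in> po_r P lt ` trim_types_at W P lt X x)"
proof -
  have "x \<notin> W closure_of part_union X (po_deriv P lt \<xi> - po_K TYPE('o) P lt) \<longleftrightarrow>
        (\<exists>p\<in>trim_types_at W P lt X x. p \<notin> po_down P lt (po_deriv P lt \<xi> - po_K TYPE('o) P lt))"
    for \<xi> :: 'o
    using mem_closure_iff[OF assms, of "po_deriv P lt \<xi> - po_K TYPE('o) P lt"] po_deriv_subset
    by blast
  then show ?thesis
    using Least_Bex_eq_Least_image[OF trim_types_at_nonempty[OF assms] ex_notin_po_down]
    unfolding sp_r_def po_r_def sp_deriv_minus_K by simp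
qed

text \<open>The derivatives decrease, so an element that has left the down-set never returns:
  membership at \<xi> means precisely that the minimum has not been reached.\<close>

lemma less_po_r_iff:
  "\<xi> < po_r P lt p \<longleftrightarrow> p \<in> po_down P lt (po_deriv P lt \<xi> - po_K TYPE('o) P lt)"
  for \<xi> :: "'o::{wellorder,no_top}"
proof
  show "p \<in> po_down P lt (po_deriv P lt \<xi> - po_K TYPE('o) P lt)" if "\<xi> < po_r P lt p"
    using not_less_Least that unfolding po_r_def by blast
next
  assume p: "p \<in> po_down P lt (po_deriv P lt \<xi> - po_K TYPE('o) P lt)"
  show "\<xi> < po_r P lt p"
  proof (rule ccontr)
    assume "\<not> \<xi> < po_r P lt p"
    then have "po_deriv P lt \<xi> \<subseteq> po_deriv P lt (po_r P lt p :: 'o)"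
      unfolding po_deriv_def by (intro iterate_deriv_antimono) auto
    then have "p \<in> po_down P lt (po_deriv P lt (po_r P lt p :: 'o) - po_K TYPE('o) P lt)"
      using p by (auto simp: po_down_def)
    then show False
      using LeastI_ex[OF ex_notin_po_down, of p] unfolding po_r_def by blast
  qed
qed

section \<open>The level sets of r on the kernel\<close>

text \<open>By \<open>sp_r_eq_Least\<close> the value at \<open>x\<close> is a minimum over a
  nonempty set, hence attained, and it exceeds \<xi> exactly when all members do.\<close>

lemma less_sp_r_iff:
  fixes \<xi> :: "'o::{wellorder,no_top}"
  assumes "x \<in> topspace W"
  shows "\<xi> < sp_r W x \<longleftrightarrow> (\<forall>p\<in>trim_types_at W P lt X x. \<xi> < po_r P lt p)"
proof -
  let ?M = "po_r P lt ` trim_types_at W P lt X x :: 'o set"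
  have "(LEAST \<alpha>. \<alpha> \<in> ?M) \<in> ?M"
    by (rule LeastI_ex) (use trim_types_at_nonempty[OF assms] in blast)
  moreover have "(LEAST \<alpha>. \<alpha> \<in> ?M) \<le> po_r P lt p" if "p \<in> trim_types_at W P lt X x" for p
    using that by (intro Least_le) blast
  ultimately show ?thesis
    unfolding sp_r_eq_Least[OF assms] by (metis (no_types, lifting) imageE less_le_trans)
qed

text \<open>Both sides equal the closed set \<open>?S\<close>, the part of the kernel of
  \<open>W\<close> in the closure of the blocks indexed by \<open>?Q\<close>: the threshold
  descriptions of \<open>sp_r\<close> and \<open>po_r\<close> turn both level conditions into the
  closure criterion.\<close>

lemma sp_K_level_eq:
  "sp_K_level W \<xi> = W closure_of part_union X (po_K_level P lt \<xi>)" (is "?L = W closure_of ?R")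
  for \<xi> :: "'o::{wellorder,no_top}"
proof -
  let ?K = "po_K TYPE('o) P lt"
  let ?Q = "po_deriv P lt \<xi> - ?K"
  have level: "po_K_level P lt \<xi> = {p \<in> ?K. p \<in> po_down P lt ?Q}"
    by (simp add: po_K_level_def less_po_r_iff)
  then have levelP: "po_K_level P lt \<xi> \<subseteq> P" using po_K_subset[where ?'o = 'o] by blast
  have QP: "?Q \<subseteq> P" using po_deriv_subset by blast
  have closureK: "W closure_of part_union X ?K = part_space ?K"
    using closure_part_union_saturated saturated_po_K by blast
  have L: "?L = part_space ?K \<inter> W closure_of part_union X ?Q" (is "_ = ?S")
  proof -
    have "\<xi> < sp_r W x \<longleftrightarrow> x \<in> W closure_of part_union X ?Q" if "x \<in> part_space ?K" for x
    proof -
      have "x \<in> topspace W"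
        using that closedin_subset[OF closedin_part_space[OF saturated_po_K[where ?'o = 'o]]] by blast
      then show ?thesis
        unfolding less_sp_r_iff[OF \<open>x \<in> topspace W\<close>] less_po_r_iff mem_closure_iff[OF \<open>x \<in> topspace W\<close> QP]
        by blast
    qed
    then show ?thesis unfolding sp_K_level_def sp_K_eq by blast
  qed
  have "?S \<subseteq> W closure_of ?R"
  proof
    fix x assume x: "x \<in> ?S"
    then have xW: "x \<in> topspace W" by (simp add: in_closure_of)
    show "x \<in> W closure_of ?R"
    proof (cases "x \<in> limpts")
      case True
      \<comment> \<open>Saturation puts the types at a limit point into \<open>?K\<close>, the
        closure criterion puts them below \<open>?Q\<close>, and \<open>level\<close> combines the
        two.\<close>
      then have "trim_types_at W P lt X x \<subseteq> po_K_level P lt \<xi>"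
        using x mem_closure_iff[OF xW QP] saturated_types_at_limit_part[OF saturated_po_K[where ?'o = 'o]]
        unfolding level by blast
      then show ?thesis
        using mem_closure_iff[OF xW levelP] levelP by (fastforce simp: po_down_def po_le_def)
    next
      case False
      then obtain p where p: "p \<in> ?K" "x \<in> X p" using x by (auto simp: part_union_def)
      then have "p \<in> po_K_level P lt \<xi>"
        using x mem_closure_X_iff[OF p(2) _ QP] po_K_subset[where ?'o = 'o] unfolding level by blast
      then show ?thesis
        using p closure_of_subset[OF part_union_subset[OF levelP]] by (auto simp: part_union_def)
    qed
  qed
  moreover have "W closure_of ?R \<subseteq> ?S"
  proof (rule closure_of_minimal)
    have "x \<in> ?S" if "p \<in> po_K_level P lt \<xi>" "x \<in> X p" for p x
      using that levelP mem_closure_X_iff[OF that(2) _ QP] unfolding level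
      by (auto simp: part_union_def)
    then show "?R \<subseteq> ?S" unfolding part_union_def by blast
    show "closedin W ?S"
      using closedin_part_space[OF saturated_po_K[where ?'o = 'o]] by (simp add: closedin_Int)
  qed
  ultimately show ?thesis using L by blast
qed

lemma PO_system_subset: "Q \<subseteq> P \<Longrightarrow> PO_system Q lt"
  using PO unfolding PO_system_def by (meson antisymp_on_subset transp_on_subset)

end

section \<open>Derivatives and invariants collected\<close>

theorem theorem14:
  fixes W :: "'w topology"
    and P :: "'p set"
    and lt :: "'p \<Rightarrow> 'p \<Rightarrow> bool"
    and X :: "'p \<Rightarrow> 'w set"
  assumes long: "topspace W \<prec> (UNIV :: 'o::{wellorder,no_top} set)"
    and "omega_Stone_space W"
    and "primitive_space W"
    and "PO_system P lt"
    and "trim_partition W P lt X"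
  shows "(\<forall>\<xi>::'o.
            sp_layer W \<xi> = part_union X (po_layer P lt \<xi>) \<and>
            sp_deriv W \<xi> = part_union X (po_deriv P lt \<xi>) \<union> limit_part W P X \<and>
            omega_Stone_space (subtopology W (sp_deriv W \<xi>)) \<and>
            PO_system (po_deriv P lt \<xi>) lt \<and>
            trim_partition (subtopology W (sp_deriv W \<xi>)) (po_deriv P lt \<xi>) lt X) \<and>
         (sp_nu W :: 'o) = po_nu P lt \<and>
         (sp_lambda W :: 'o) = po_lambda P lt \<and>
         sp_K TYPE('o) W = part_union X (po_K TYPE('o) P lt) \<union> limit_part W P X \<and>
         sp_K TYPE('o) W = W closure_of (part_union X (po_K TYPE('o) P lt)) \<and>
         (\<forall>\<xi>::'o. sp_K_level W \<xi> = W closure_of (part_union X (po_K_level P lt \<xi>))) \<and>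
         (\<forall>p\<in>po_K TYPE('o) P lt. \<forall>x\<in>X p. (sp_r W x :: 'o) = po_r P lt p) \<and>
         (\<forall>x\<in>limit_part W P X.
            (sp_r W x :: 'o) = (LEAST \<alpha>. \<alpha> \<in> po_r P lt ` trim_types_at W P lt X x))"
proof -
  interpret trim_partitioned_space W P lt X
    using assms by unfold_locales (auto simp: omega_Stone_space_def)
  have "sp_layer W \<xi> = part_union X (po_layer P lt \<xi>) \<and>
      sp_deriv W \<xi> = part_union X (po_deriv P lt \<xi>) \<union> limit_part W P X \<and>
      omega_Stone_space (subtopology W (sp_deriv W \<xi>)) \<and>
      PO_system (po_deriv P lt \<xi>) lt \<and>
      trim_partition (subtopology W (sp_deriv W \<xi>)) (po_deriv P lt \<xi>) lt X" for \<xi> :: 'o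
    unfolding sp_deriv_eq
    using sp_layer_eq PO_system_subset[OF po_deriv_subset] trim_partition_subtopology
      omega_Stone_space_closed_subspace[OF assms(2) closedin_part_space] saturated_po_deriv
    by blast
  moreover have "sp_K TYPE('o) W = W closure_of (part_union X (po_K TYPE('o) P lt))"
    using closure_part_union_saturated[OF saturated_po_K[where ?'o = 'o]] by (simp add: sp_K_eq)
  moreover have "(sp_r W x :: 'o) = po_r P lt p" if "p \<in> po_K TYPE('o) P lt" "x \<in> X p" for p x
    using that sp_r_eq_po_r po_K_subset[where ?'o = 'o] by blast
  moreover have "(sp_r W x :: 'o) = (LEAST \<alpha>. \<alpha> \<in> po_r P lt ` trim_types_at W P lt X x)"
    if "x \<in> limit_part W P X" for x
    using that by (intro sp_r_eq_Least) (simp add: limit_part_def)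
  ultimately show ?thesis
    using sp_nu_eq sp_lambda_eq sp_K_eq sp_K_level_eq by blast
qed

end
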